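(* Let $n\ge 3$, let $D_n=\langle a,b \mid a^n=b^2=e,\ ba=a^{n-1}b\rangle$ be the dihedral group (of order $2n$), and let $S=\{a,a^{-1},b,b^{-1}\}$. Then the undirected Cayley graph $\Gamma(D_n,S)$ has constant Steinerberger curvature (i.e. $\mu(v)=K$ for every vertex $v$) with $$K=\frac{2n}{2\lfloor \frac n2\rfloor\left(\lfloor \frac n2\rfloor+1\right)+n^2-2n\lfloor \frac n2\rfloor},$$ where $\lfloor \frac n2\rfloor$ is the greatest integer not exceeding $\frac n2$.
   Context: Undirected Cayley graph: for a group $G$ and a subset $S\subseteq G\setminus\{e\}$ with $S=S^{-1}$, $\Gamma(G,S)$ is the simple graph with vertex set $G$ and an edge between $g$ and $gs$ for every $g\in G$, $s\in S$ (opposite arcs are identified as one edge). Steinerberger curvature: let $H=(V,E)$ be a finite simple undirected connected graph with $|V|=N$, $V=\{v_1,\dots,v_N\}$, distance matrix $D=(d(v_i,v_j))_{1\le i,j\le N}$ ($d$ the graph distance), and let $\mathbf 1\in\mathbb R^N$ be the all-ones column vector. The Steinerberger curvature of $H$ is the function $\mu:V\to\mathbb R$ (viewed as a vector in $\mathbb R^N$) defined by: (1) if $DK=N\cdot\mathbf 1$ has a unique solution $K$, then $\mu$ is that solution; (2) if it has more than one solution, $\mu$ is the solution achieving $\max_K\min_{1\le i\le N}K_i$, where $K=(K_1,\dots,K_N)$ runs over all solutions; (3) if it has no solution, $\mu=D^\dagger(N\cdot\mathbf 1)$, where $D^\dagger$ is the Moore-Penrose pseudo-inverse of $D$. *)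

theory Defs
  imports
    "HOL-Analysis.Analysis"
    "HOL-Algebra.Group"
    "Graph_Theory.Pair_Digraph"
    "Graph_Theory.Shortest_Path"
    "Jordan_Normal_Form.Matrix"
begin

section \<open>Groups given by generators and relations\<close>

text \<open>
  A word is a list of letters; \<open>(x, False)\<close> stands for the generator \<open>x\<close> and \<open>(x, True)\<close> for its
  formal inverse. All elements of the type \<open>'x\<close> are generators, and a pair \<open>(u, v)\<close> in the set of
  relations stands for the relation \<open>u = v\<close>.
\<close>

type_synonym 'x word = "('x \<times> bool) list"

inductive word_eq :: "('x word \<times> 'x word) set \<Rightarrow> 'x word \<Rightarrow> 'x word \<Rightarrow> bool"
  for R :: "('x word \<times> 'x word) set" where
  word_eq_rel: "(u, v) \<in> R \<Longrightarrow> word_eq R u v"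
| word_eq_cancel: "word_eq R [(x, e), (x, \<not> e)] []"
| word_eq_refl: "word_eq R u u"
| word_eq_sym: "word_eq R u v \<Longrightarrow> word_eq R v u"
| word_eq_trans: "word_eq R u v \<Longrightarrow> word_eq R v w \<Longrightarrow> word_eq R u w"
| word_eq_append: "word_eq R u u' \<Longrightarrow> word_eq R v v' \<Longrightarrow> word_eq R (u @ v) (u' @ v')"

definition word_class :: "('x word \<times> 'x word) set \<Rightarrow> 'x word \<Rightarrow> 'x word set" where
  "word_class R w = {v. word_eq R w v}"

definition presented_group :: "('x word \<times> 'x word) set \<Rightarrow> 'x word set monoid" where
  "presented_group R =
     \<lparr>carrier = range (word_class R),
      monoid.mult = (\<lambda>A B. \<Union>u\<in>A. \<Union>v\<in>B. word_class R (u @ v)),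
      one = word_class R []\<rparr>"

lemma word_class_eq_iff: "word_class R u = word_class R v \<longleftrightarrow> word_eq R u v"
proof
  assume "word_class R u = word_class R v"
  then have "v \<in> word_class R u" by (simp add: word_class_def word_eq_refl)
  then show "word_eq R u v" by (simp add: word_class_def)
next
  assume uv: "word_eq R u v"
  have "word_eq R u w \<longleftrightarrow> word_eq R v w" for w
    using word_eq_trans[OF uv] word_eq_trans[OF word_eq_sym[OF uv]] by metis
  then show "word_class R u = word_class R v" by (simp add: word_class_def)
qed

lemma mult_word_class:
  "word_class R u \<otimes>\<^bsub>presented_group R\<^esub> word_class R v = word_class R (u @ v)"
proof -
  have eq: "word_class R (u' @ v') = word_class R (u @ v)"
    if "u' \<in> word_class R u" "v' \<in> word_class R v" for u' v'
    using that unfolding word_class_eq_iff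
    by (intro word_eq_sym[OF word_eq_append]) (simp_all add: word_class_def)
  have self: "w \<in> word_class R w" for w
    by (simp add: word_class_def word_eq_refl)
  have "(\<Union>u'\<in>word_class R u. \<Union>v'\<in>word_class R v. word_class R (u' @ v')) =
      (\<Union>u'\<in>word_class R u. \<Union>v'\<in>word_class R v. word_class R (u @ v))"
    by (intro SUP_cong refl eq)
  also have "\<dots> = word_class R (u @ v)"
    using self[of u] self[of v] by auto
  finally show ?thesis
    by (simp add: presented_group_def)
qed

lemma group_presented_group: "group (presented_group R)"
proof (rule groupI)
  have inverse: "\<exists>v. word_eq R (v @ u) []" for u :: "'a word"
  proof (induction u)
    case Nil
    have "word_eq R ([] @ []) []" by (simp add: word_eq_refl)
    then show ?case by blast
  next
    case (Cons l u)
    then obtain v where v: "word_eq R (v @ u) []" by blast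
    obtain x e where l: "l = (x, e)" by force
    have "word_eq R ([(x, \<not> e), (x, e)] @ u) ([] @ u)"
      using word_eq_cancel[of R x "\<not> e"] by (intro word_eq_append word_eq_refl) simp
    then have "word_eq R (v @ ([(x, \<not> e), (x, e)] @ u)) (v @ u)"
      by (intro word_eq_append word_eq_refl) simp
    from word_eq_trans[OF this v] have "word_eq R ((v @ [(x, \<not> e)]) @ (l # u)) []"
      by (simp add: l)
    then show ?case by blast
  qed
  fix A assume "A \<in> carrier (presented_group R)"
  then obtain u where u: "A = word_class R u" by (auto simp: presented_group_def)
  obtain v where "word_eq R (v @ u) []" using inverse by blast
  then have "word_class R v \<otimes>\<^bsub>presented_group R\<^esub> A = \<one>\<^bsub>presented_group R\<^esub>"
    unfolding u mult_word_class by (simp add: presented_group_def word_class_eq_iff)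
  then show "\<exists>B\<in>carrier (presented_group R). B \<otimes>\<^bsub>presented_group R\<^esub> A = \<one>\<^bsub>presented_group R\<^esub>"
    by (intro bexI[of _ "word_class R v"]) (auto simp: presented_group_def)
next
  have one: "\<one>\<^bsub>presented_group R\<^esub> = word_class R []"
    and carrier: "carrier (presented_group R) = range (word_class R)"
    by (auto simp: presented_group_def)
  show "\<one>\<^bsub>presented_group R\<^esub> \<in> carrier (presented_group R)"
    by (simp add: one carrier)
  show "A \<otimes>\<^bsub>presented_group R\<^esub> B \<in> carrier (presented_group R)"
    if "A \<in> carrier (presented_group R)" "B \<in> carrier (presented_group R)" for A B
    using that by (auto simp: carrier mult_word_class)
  show "(A \<otimes>\<^bsub>presented_group R\<^esub> B) \<otimes>\<^bsub>presented_group R\<^esub> C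
      = A \<otimes>\<^bsub>presented_group R\<^esub> (B \<otimes>\<^bsub>presented_group R\<^esub> C)"
    if "A \<in> carrier (presented_group R)" "B \<in> carrier (presented_group R)"
      "C \<in> carrier (presented_group R)" for A B C
    using that by (auto simp: carrier mult_word_class)
  show "\<one>\<^bsub>presented_group R\<^esub> \<otimes>\<^bsub>presented_group R\<^esub> A = A"
    if "A \<in> carrier (presented_group R)" for A
    using that by (auto simp: carrier one mult_word_class)
qed


section \<open>Dihedral groups\<close>

datatype dihedral_gen = Gen_a | Gen_b

definition dihedral_relations :: "nat \<Rightarrow> (dihedral_gen word \<times> dihedral_gen word) set" where
  "dihedral_relations n =
     (let a = (Gen_a, False); b = (Gen_b, False)
      in {(replicate n a, []), ([b, b], []), ([b, a], replicate (n - 1) a @ [b])})"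

definition dihedral_group :: "nat \<Rightarrow> dihedral_gen word set monoid" where
  "dihedral_group n = presented_group (dihedral_relations n)"

definition dihedral_a :: "nat \<Rightarrow> dihedral_gen word set" where
  "dihedral_a n = word_class (dihedral_relations n) [(Gen_a, False)]"

definition dihedral_b :: "nat \<Rightarrow> dihedral_gen word set" where
  "dihedral_b n = word_class (dihedral_relations n) [(Gen_b, False)]"


section \<open>Cayley graphs and graph distance\<close>

text \<open>
  A simple undirected graph is represented, as in \<open>Graph_Theory\<close>, by a symmetric irreflexive set of
  arcs (locale \<open>pair_graph\<close>): an edge is a pair of opposite arcs.
\<close>

definition cayley_graph :: "('g, 'm) monoid_scheme \<Rightarrow> 'g set \<Rightarrow> 'g pair_pre_digraph" where
  "cayley_graph G S =
     \<lparr>pverts = carrier G, parcs = {(g, g \<otimes>\<^bsub>G\<^esub> s) | g s. g \<in> carrier G \<and> s \<in> S}\<rparr>"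

lemma pair_graph_cayley_graph:
  assumes "group G" and "finite (carrier G)"
    and S: "S \<subseteq> carrier G - {\<one>\<^bsub>G\<^esub>}" and inv_S: "m_inv G ` S = S"
  shows "pair_graph (cayley_graph G S)"
proof -
  interpret group G by fact
  let ?H = "cayley_graph G S"
  have arcs: "parcs ?H = (\<lambda>(g, s). (g, g \<otimes>\<^bsub>G\<^esub> s)) ` (carrier G \<times> S)"
    by (auto simp: cayley_graph_def)
  have "finite S" using S assms(2) by (meson Diff_subset finite_subset subset_trans)
  then have "finite (parcs ?H)" using assms(2) by (simp add: arcs)
  moreover have "fst e \<in> pverts ?H" "snd e \<in> pverts ?H" "fst e \<noteq> snd e" if "e \<in> parcs ?H" for e
    using that S by (auto simp: cayley_graph_def)
  moreover have "(h, g) \<in> parcs ?H" if arc: "(g, h) \<in> parcs ?H" for g h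
  proof -
    obtain s where s: "g \<in> carrier G" "s \<in> S" "h = g \<otimes>\<^bsub>G\<^esub> s"
      using arc by (auto simp: cayley_graph_def)
    have s': "s \<in> carrier G" "inv\<^bsub>G\<^esub> s \<in> S" using s(2) S inv_S by blast+
    have "g = h \<otimes>\<^bsub>G\<^esub> inv\<^bsub>G\<^esub> s" "h \<in> carrier G" using s s' by (simp_all add: m_assoc)
    with s'(2) have "\<exists>t. g = h \<otimes>\<^bsub>G\<^esub> t \<and> h \<in> carrier G \<and> t \<in> S" by blast
    then show ?thesis by (simp add: cayley_graph_def)
  qed
  ultimately show ?thesis
    using assms(2)
    by unfold_locales (simp_all add: symmetric_def sym_def cayley_graph_def)
qed

definition graph_dist :: "'v pair_pre_digraph \<Rightarrow> 'v \<Rightarrow> 'v \<Rightarrow> real" where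
  "graph_dist H u v = real_of_ereal (wf_digraph.\<mu> (with_proj H) (\<lambda>_. 1) u v)"

definition distance_mat :: "'v pair_pre_digraph \<Rightarrow> 'v list \<Rightarrow> real mat" where
  "distance_mat H vs =
     mat (length vs) (length vs) (\<lambda>(i, j). graph_dist H (vs ! i) (vs ! j))"


section \<open>Steinerberger curvature\<close>

definition moore_penrose :: "real mat \<Rightarrow> real mat" where
  "moore_penrose A = (THE X. X \<in> carrier_mat (dim_col A) (dim_row A) \<and>
     A * X * A = A \<and> X * A * X = X \<and>
     transpose_mat (A * X) = A * X \<and> transpose_mat (X * A) = X * A)"

definition scaled_ones :: "nat \<Rightarrow> real vec" where
  "scaled_ones N = real N \<cdot>\<^sub>v vec N (\<lambda>_. 1)"

definition curvature_solutions :: "real mat \<Rightarrow> real vec set" where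
  "curvature_solutions D =
     {K \<in> carrier_vec (dim_col D). D *\<^sub>v K = scaled_ones (dim_row D)}"

text \<open>
  In the second case the maximiser is taken with a definite description: a statement about the value
  presupposes that exactly one solution attains the maximum.
\<close>

definition curvature_vec :: "real mat \<Rightarrow> real vec" where
  "curvature_vec D =
     (if \<exists>!K. K \<in> curvature_solutions D then THE K. K \<in> curvature_solutions D
      else if curvature_solutions D \<noteq> {} then
        THE K. is_arg_max (\<lambda>K. MIN i\<in>{..<dim_vec K}. K $ i) (\<lambda>K. K \<in> curvature_solutions D) K
      else moore_penrose D *\<^sub>v scaled_ones (dim_row D))"

text \<open>
  The curvature of a vertex does not depend on the enumeration \<open>vs\<close> of the vertices: permuting it
  permutes the rows and columns of the distance matrix and the entries of the curvature vector alike.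
\<close>

definition steinerberger_curvature :: "'v pair_pre_digraph \<Rightarrow> 'v \<Rightarrow> real" where
  "steinerberger_curvature H v =
     (let vs = (SOME vs. distinct vs \<and> set vs = pverts H)
      in curvature_vec (distance_mat H vs) $ (THE i. i < length vs \<and> vs ! i = v))"

end

theory Submission
  imports Defs
begin

text \<open>
  A Cayley graph looks the same from every vertex: left multiplication by \<open>g\<inverse>\<close> carries the distances
  from \<open>g\<close> to the distances from \<open>\<one>\<close>, that is, to the word length of the group elements. Hence all row
  and column sums of the distance matrix \<open>D\<close> equal the total word length \<open>r\<close>, and the constant vector
  \<open>|G| / r\<close> solves \<open>D K = |G| \<cdot> 1\<close>. Whether or not it is the only solution, the curvature is this
  constant: multiplying the equation by the all-ones row vector shows that every solution has mean
  \<open>|G| / r\<close>, so that its least entry is at most \<open>|G| / r\<close>, with equality only for the constant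
  solution. This gives \<open>steinerberger_curvature_cayley_graph\<close>, in which the word length is any function
  that vanishes at \<open>\<one>\<close>, grows by at most one along an arc, and has a descent at every other element.

  It remains to sum the word lengths in the dihedral group. Writing each element as \<open>a\<^sup>i b\<^sup>e\<close> with
  \<open>0 \<le> i < n\<close> and \<open>e \<in> {0, 1}\<close> exhibits the graph as a prism: the generator \<open>a\<close> moves \<open>i\<close> along an
  \<open>n\<close>-cycle, in a direction that depends on \<open>e\<close>, and \<open>b\<close> changes only \<open>e\<close>. The word length is therefore
  \<open>min i (n - i) + e\<close>. These normal forms are pairwise distinct because the words act on the pairs
  \<open>(i, e)\<close> in a way that respects the relations (\<open>dihedral_act_cong\<close>), and they exhaust the group by
  induction on words (\<open>normal_form_act\<close>).
\<close>

section \<open>Distances in Cayley graphs\<close>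

text \<open>
  A potential certifies distances: since \<open>f\<close> grows by at most one along an arc, no walk from \<open>u\<close> to \<open>v\<close>
  is shorter than \<open>f v\<close>; following the descents backwards from \<open>v\<close> must end at \<open>u\<close> and yields a walk
  of that length.
\<close>

lemma graph_dist_eqI:
  fixes f :: "'v \<Rightarrow> nat"
  assumes "pair_wf_digraph H" and u: "u \<in> pverts H" and v: "v \<in> pverts H"
    and source: "f u = 0"
    and up: "\<And>x y. (x, y) \<in> parcs H \<Longrightarrow> f y \<le> Suc (f x)"
    and down: "\<And>y. y \<in> pverts H \<Longrightarrow> y \<noteq> u \<Longrightarrow> \<exists>x. (x, y) \<in> parcs H \<and> f y = Suc (f x)"
  shows "graph_dist H u v = real (f v)"
proof -
  interpret pair_wf_digraph H by fact
  have cost: "awalk_cost (\<lambda>_. 1) p = real (length p)" for p :: "('v \<times> 'v) list"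
    by (induction p) auto
  have lower: "f y \<le> f x + length p" if "awalk x p y" for x p y
    using that
  proof (induction p arbitrary: x)
    case Nil
    then show ?case by (simp add: awalk_Nil_iff)
  next
    case (Cons e p)
    obtain z where e: "e = (x, z)" "(x, z) \<in> parcs H" "awalk z p y"
      using Cons.prems by (cases e) (auto simp: awalk_Cons_iff)
    show ?case using Cons.IH[OF e(3)] up[OF e(2)] by simp
  qed
  have upper: "\<exists>p. awalk u p y \<and> length p = f y" if "y \<in> pverts H" for y
    using that
  proof (induction "f y" arbitrary: y)
    case 0
    then have "y = u" using down[of y] by auto
    then show ?case using u source by (intro exI[of _ "[]"]) (simp add: awalk_Nil_iff)
  next
    case (Suc k)
    then have "y \<noteq> u" using source by auto
    then obtain x where x: "(x, y) \<in> parcs H" "f y = Suc (f x)" using down Suc.prems by blast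
    then have "k = f x" "x \<in> pverts H" using Suc.hyps(2) in_arcsD1 by auto
    then obtain p where "awalk u p x" "length p = f x" using Suc.hyps(1) by blast
    moreover have "awalk x [(x, y)] y"
      using x(1) by (auto simp: awalk_Cons_iff awalk_Nil_iff intro: in_arcsD1 in_arcsD2)
    ultimately have "awalk u (p @ [(x, y)]) y" "length (p @ [(x, y)]) = f y"
      using x(2) by (auto intro: awalk_appendI)
    then show ?case by blast
  qed
  obtain p where p: "awalk u p v" "length p = f v" using upper v by blast
  have "\<mu> (\<lambda>_. 1) u v = ereal (real (f v))"
  proof (rule antisym)
    show "\<mu> (\<lambda>_. 1) u v \<le> ereal (real (f v))"
      using min_cost_le_walk_cost[OF p(1), of "\<lambda>_. 1"] by (simp add: cost p(2))
    have "f v \<le> length q" if "awalk u q v" for q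
      using lower[OF that] source by simp
    then show "ereal (real (f v)) \<le> \<mu> (\<lambda>_. 1) u v"
      unfolding \<mu>_def by (auto intro!: INF_greatest simp: cost)
  qed
  then show ?thesis by (simp add: graph_dist_def)
qed

text \<open>
  The potential for the source \<open>g\<close> is \<open>len\<close> transported by the left translation, because left
  translations commute with the right multiplications that define the arcs.
\<close>

lemma graph_dist_cayley_graph:
  fixes len :: "'g \<Rightarrow> nat"
  assumes "group G" and S: "S \<subseteq> carrier G" and one: "len \<one>\<^bsub>G\<^esub> = 0"
    and up: "\<And>x s. x \<in> carrier G \<Longrightarrow> s \<in> S \<Longrightarrow> len (x \<otimes>\<^bsub>G\<^esub> s) \<le> Suc (len x)"
    and down: "\<And>y. y \<in> carrier G \<Longrightarrow> y \<noteq> \<one>\<^bsub>G\<^esub> \<Longrightarrow>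
      \<exists>x\<in>carrier G. \<exists>s\<in>S. y = x \<otimes>\<^bsub>G\<^esub> s \<and> len y = Suc (len x)"
    and g: "g \<in> carrier G" and h: "h \<in> carrier G"
  shows "graph_dist (cayley_graph G S) g h = real (len (inv\<^bsub>G\<^esub> g \<otimes>\<^bsub>G\<^esub> h))"
proof -
  interpret group G by fact
  have wf: "pair_wf_digraph (cayley_graph G S)"
    using S by unfold_locales (auto simp: cayley_graph_def)
  show ?thesis
  proof (rule graph_dist_eqI[OF wf, of g h "\<lambda>x. len (inv\<^bsub>G\<^esub> g \<otimes>\<^bsub>G\<^esub> x)"])
    show "g \<in> pverts (cayley_graph G S)" "h \<in> pverts (cayley_graph G S)"
      using g h by (simp_all add: cayley_graph_def)
    show "len (inv\<^bsub>G\<^esub> g \<otimes>\<^bsub>G\<^esub> g) = 0" using g one by simp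
  next
    fix x y assume "(x, y) \<in> parcs (cayley_graph G S)"
    then obtain s where s: "x \<in> carrier G" "s \<in> S" "y = x \<otimes>\<^bsub>G\<^esub> s"
      by (auto simp: cayley_graph_def)
    then have "inv\<^bsub>G\<^esub> g \<otimes>\<^bsub>G\<^esub> y = (inv\<^bsub>G\<^esub> g \<otimes>\<^bsub>G\<^esub> x) \<otimes>\<^bsub>G\<^esub> s"
      using g S by (auto simp: m_assoc)
    then show "len (inv\<^bsub>G\<^esub> g \<otimes>\<^bsub>G\<^esub> y) \<le> Suc (len (inv\<^bsub>G\<^esub> g \<otimes>\<^bsub>G\<^esub> x))"
      using up[of "inv\<^bsub>G\<^esub> g \<otimes>\<^bsub>G\<^esub> x" s] s g by simp
  next
    fix y assume "y \<in> pverts (cayley_graph G S)" "y \<noteq> g"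
    then have y: "y \<in> carrier G" by (simp add: cayley_graph_def)
    have "inv\<^bsub>G\<^esub> g \<otimes>\<^bsub>G\<^esub> y \<noteq> \<one>\<^bsub>G\<^esub>"
      using y g \<open>y \<noteq> g\<close> by (metis inv_inv inv_equality inv_closed)
    then obtain x s where xs: "x \<in> carrier G" "s \<in> S"
      "inv\<^bsub>G\<^esub> g \<otimes>\<^bsub>G\<^esub> y = x \<otimes>\<^bsub>G\<^esub> s" "len (inv\<^bsub>G\<^esub> g \<otimes>\<^bsub>G\<^esub> y) = Suc (len x)"
      using down[of "inv\<^bsub>G\<^esub> g \<otimes>\<^bsub>G\<^esub> y"] y g by auto
    have "y = g \<otimes>\<^bsub>G\<^esub> (inv\<^bsub>G\<^esub> g \<otimes>\<^bsub>G\<^esub> y)" using y g by (simp add: m_assoc[symmetric])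
    also have "\<dots> = (g \<otimes>\<^bsub>G\<^esub> x) \<otimes>\<^bsub>G\<^esub> s" using xs S g by (auto simp: m_assoc)
    finally have "(g \<otimes>\<^bsub>G\<^esub> x, y) \<in> parcs (cayley_graph G S)"
      using xs g by (auto simp: cayley_graph_def)
    moreover have "inv\<^bsub>G\<^esub> g \<otimes>\<^bsub>G\<^esub> (g \<otimes>\<^bsub>G\<^esub> x) = x" using xs g by (simp add: m_assoc[symmetric])
    ultimately show "\<exists>x. (x, y) \<in> parcs (cayley_graph G S) \<and>
        len (inv\<^bsub>G\<^esub> g \<otimes>\<^bsub>G\<^esub> y) = Suc (len (inv\<^bsub>G\<^esub> g \<otimes>\<^bsub>G\<^esub> x))"
      using xs(4) by (intro exI[of _ "g \<otimes>\<^bsub>G\<^esub> x"]) simp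
  qed
qed

section \<open>Curvature of a graph with constant distance sums\<close>

text \<open>
  Constant row sums make the constant vector a solution. Constant column sums fix the mean of every
  solution, which makes that vector the unique maximiser of the least entry.
\<close>

lemma curvature_vec_const:
  fixes D :: "real mat"
  assumes D: "D \<in> carrier_mat N N" and N: "N > 0" and r: "r \<noteq> 0"
    and rows: "\<And>i. i < N \<Longrightarrow> (\<Sum>j<N. D $$ (i, j)) = r"
    and cols: "\<And>j. j < N \<Longrightarrow> (\<Sum>i<N. D $$ (i, j)) = r"
  shows "curvature_vec D = Matrix.vec N (\<lambda>_. real N / r)"
proof -
  define K0 where "K0 = Matrix.vec N (\<lambda>_. real N / r)"
  have sol_iff: "K \<in> curvature_solutions D \<longleftrightarrow>
      K \<in> carrier_vec N \<and> (\<forall>i<N. (\<Sum>j<N. D $$ (i, j) * vec_index K j) = real N)" for K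
    using D unfolding curvature_solutions_def scaled_ones_def
    by (auto simp: vec_eq_iff scalar_prod_def atLeast0LessThan)
  have K0: "K0 \<in> curvature_solutions D"
  proof -
    have "(\<Sum>j<N. D $$ (i, j) * (real N / r)) = real N" if "i < N" for i
      using rows[OF that] r by (simp add: sum_distrib_right[symmetric] sum_divide_distrib[symmetric])
    then show ?thesis by (auto simp: sol_iff K0_def)
  qed
  \<comment> \<open>Sum all \<open>N\<close> equations: each entry of \<open>K\<close> is then weighted by a column sum.\<close>
  have total: "(\<Sum>j<N. vec_index K j) = N * (real N / r)" if "K \<in> curvature_solutions D" for K
  proof -
    have "real N * real N = (\<Sum>i<N. \<Sum>j<N. D $$ (i, j) * vec_index K j)"
      using that by (simp add: sol_iff)
    also have "\<dots> = (\<Sum>j<N. \<Sum>i<N. D $$ (i, j) * vec_index K j)" by (rule sum.swap)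
    also have "\<dots> = (\<Sum>j<N. r * vec_index K j)"
      by (intro sum.cong) (simp_all add: sum_distrib_right[symmetric] cols)
    also have "\<dots> = r * (\<Sum>j<N. vec_index K j)" by (simp add: sum_distrib_left)
    finally show ?thesis using r by (simp add: field_simps)
  qed
  define m where "m K = (MIN i\<in>{..<dim_vec K}. vec_index K i)" for K :: "real Matrix.vec"
  have m_K0: "m K0 = real N / r"
  proof -
    have "(\<lambda>i. vec_index K0 i) ` {..<dim_vec K0} = {real N / r}"
      using N by (auto simp: K0_def image_iff)
    then show ?thesis by (simp add: m_def)
  qed
  \<comment> \<open>If no entry lies below the mean, then all entries equal the mean.\<close>
  have const: "K = K0" if K: "K \<in> curvature_solutions D" and ge: "m K \<ge> real N / r" for K
  proof -
    have dim: "dim_vec K = N" using K by (auto simp: sol_iff)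
    have entry: "real N / r \<le> vec_index K i" if "i < N" for i
      using ge that by (auto simp: m_def dim intro: order_trans[OF _ Min_le])
    have "(\<Sum>i<N. vec_index K i - real N / r) = 0"
      using total[OF K] by (simp add: sum_subtractf)
    then have "\<forall>i\<in>{..<N}. vec_index K i - real N / r = 0"
      using entry by (subst (asm) sum_nonneg_eq_0_iff) auto
    then show ?thesis by (intro eq_vecI) (auto simp: K0_def dim)
  qed
  have "curvature_vec D = K0"
  proof (cases "\<exists>!K. K \<in> curvature_solutions D")
    case True
    then show ?thesis using K0 by (simp add: curvature_vec_def the1_equality)
  next
    case False
    have "is_arg_max m (\<lambda>K. K \<in> curvature_solutions D) K \<longleftrightarrow> K = K0" for K
      unfolding is_arg_max_def using K0 const m_K0 by (metis linorder_not_less order_refl less_imp_le)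
    then have "(THE K. is_arg_max m (\<lambda>K. K \<in> curvature_solutions D) K) = K0" by simp
    then show ?thesis using False K0 by (auto simp: curvature_vec_def m_def[abs_def])
  qed
  then show ?thesis by (simp add: K0_def)
qed

lemma steinerberger_curvature_const:
  fixes H :: "'v pair_pre_digraph"
  assumes fin: "finite (pverts H)" and r: "r \<noteq> 0"
    and rows: "\<And>u. u \<in> pverts H \<Longrightarrow> (\<Sum>v\<in>pverts H. graph_dist H u v) = r"
    and cols: "\<And>v. v \<in> pverts H \<Longrightarrow> (\<Sum>u\<in>pverts H. graph_dist H u v) = r"
    and v: "v \<in> pverts H"
  shows "steinerberger_curvature H v = real (card (pverts H)) / r"
proof -
  define vs where "vs = (SOME vs. distinct vs \<and> set vs = pverts H)"
  have vs: "distinct vs" "set vs = pverts H"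
    using someI_ex[OF finite_distinct_list[OF fin]] unfolding vs_def by (metis (mono_tags, lifting) someI)+
  define N where "N = length vs"
  have N: "N = card (pverts H)" using vs by (metis N_def distinct_card)
  have nth: "vs ! i \<in> pverts H" if "i < N" for i
    using that vs by (metis N_def nth_mem)
  have reindex: "(\<Sum>i<N. f (vs ! i)) = (\<Sum>v\<in>pverts H. f v)" for f :: "'v \<Rightarrow> real"
    using sum.reindex_bij_betw[OF bij_betw_nth[OF vs(1) refl refl], of f] by (simp add: vs(2) N_def)
  obtain k where k: "k < N" "vs ! k = v" using v vs by (metis N_def in_set_conv_nth)
  have the_k: "(THE i. i < length vs \<and> vs ! i = v) = k"
    using k vs(1) by (auto simp: N_def nth_eq_iff_index_eq)
  have "curvature_vec (distance_mat H vs) = Matrix.vec N (\<lambda>_. real N / r)"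
  proof (rule curvature_vec_const)
    show "distance_mat H vs \<in> carrier_mat N N" by (simp add: distance_mat_def N_def)
    show "N > 0" using k by simp
    show "(\<Sum>j<N. distance_mat H vs $$ (i, j)) = r" if "i < N" for i
      using that rows[OF nth[OF that]] reindex[of "graph_dist H (vs ! i)"]
      by (simp add: distance_mat_def N_def)
    show "(\<Sum>i<N. distance_mat H vs $$ (i, j)) = r" if "j < N" for j
      using that cols[OF nth[OF that]] reindex[of "\<lambda>u. graph_dist H u (vs ! j)"]
      by (simp add: distance_mat_def N_def)
  qed (fact r)
  then show ?thesis
    using k by (simp add: steinerberger_curvature_def vs_def[symmetric] the_k N)
qed

text \<open>
  Both \<open>h \<mapsto> g\<inverse> h\<close> and \<open>g \<mapsto> g\<inverse> h\<close> are permutations of the group, so the distances from a vertex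
  and the distances to a vertex both add up to the total word length.
\<close>

lemma steinerberger_curvature_cayley_graph:
  fixes len :: "'g \<Rightarrow> nat"
  assumes "group G" and fin: "finite (carrier G)" and S: "S \<subseteq> carrier G"
    and one: "len \<one>\<^bsub>G\<^esub> = 0"
    and up: "\<And>x s. x \<in> carrier G \<Longrightarrow> s \<in> S \<Longrightarrow> len (x \<otimes>\<^bsub>G\<^esub> s) \<le> Suc (len x)"
    and down: "\<And>y. y \<in> carrier G \<Longrightarrow> y \<noteq> \<one>\<^bsub>G\<^esub> \<Longrightarrow>
      \<exists>x\<in>carrier G. \<exists>s\<in>S. y = x \<otimes>\<^bsub>G\<^esub> s \<and> len y = Suc (len x)"
    and nontrivial: "(\<Sum>x\<in>carrier G. len x) \<noteq> 0"
    and v: "v \<in> pverts (cayley_graph G S)"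
  shows "steinerberger_curvature (cayley_graph G S) v =
    real (card (carrier G)) / real (\<Sum>x\<in>carrier G. len x)"
proof -
  interpret group G by fact
  have verts: "pverts (cayley_graph G S) = carrier G" by (simp add: cayley_graph_def)
  have dist: "graph_dist (cayley_graph G S) g h = real (len (inv\<^bsub>G\<^esub> g \<otimes>\<^bsub>G\<^esub> h))"
    if "g \<in> carrier G" "h \<in> carrier G" for g h
    by (rule graph_dist_cayley_graph[OF \<open>group G\<close> S one up down that])
  have rows: "(\<Sum>h\<in>carrier G. graph_dist (cayley_graph G S) g h) = real (\<Sum>x\<in>carrier G. len x)"
    if g: "g \<in> carrier G" for g
  proof -
    have "(\<Sum>h\<in>carrier G. real (len (inv\<^bsub>G\<^esub> g \<otimes>\<^bsub>G\<^esub> h))) = (\<Sum>x\<in>carrier G. real (len x))"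
      by (rule sum.reindex_bij_witness[of _ "\<lambda>x. g \<otimes>\<^bsub>G\<^esub> x" "\<lambda>h. inv\<^bsub>G\<^esub> g \<otimes>\<^bsub>G\<^esub> h"])
        (use g in \<open>auto simp: m_assoc[symmetric]\<close>)
    then show ?thesis using g by (simp add: dist)
  qed
  have cols: "(\<Sum>g\<in>carrier G. graph_dist (cayley_graph G S) g h) = real (\<Sum>x\<in>carrier G. len x)"
    if h: "h \<in> carrier G" for h
  proof -
    have "(\<Sum>g\<in>carrier G. real (len (inv\<^bsub>G\<^esub> g \<otimes>\<^bsub>G\<^esub> h))) = (\<Sum>x\<in>carrier G. real (len x))"
      by (rule sum.reindex_bij_witness[of _ "\<lambda>x. h \<otimes>\<^bsub>G\<^esub> inv\<^bsub>G\<^esub> x" "\<lambda>g. inv\<^bsub>G\<^esub> g \<otimes>\<^bsub>G\<^esub> h"])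
        (use h in \<open>auto simp: m_assoc[symmetric] inv_mult_group, simp_all add: m_assoc\<close>)
    then show ?thesis using h by (simp add: dist)
  qed
  show ?thesis
    using steinerberger_curvature_const[of "cayley_graph G S" "real (\<Sum>x\<in>carrier G. len x)" v]
      fin nontrivial rows cols v
    unfolding verts of_nat_eq_0_iff by blast
qed

section \<open>Normal forms in the dihedral group\<close>

text \<open>
  The pair \<open>(i, e)\<close> stands for \<open>a\<^sup>i b\<^sup>e\<close>, and a step is the right multiplication by a letter. Moving the
  letter \<open>a\<close> or its inverse to the left past \<open>b\<^sup>e\<close> inverts it when \<open>e\<close> holds, which is why the sign
  is decided by comparing \<open>e\<close> with the inversion mark \<open>c\<close>.
\<close>

fun dihedral_step :: "nat \<Rightarrow> int \<times> bool \<Rightarrow> dihedral_gen \<times> bool \<Rightarrow> int \<times> bool" where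
  "dihedral_step n (i, e) (Gen_a, c) = ((if e = c then i + 1 else i - 1) mod int n, e)"
| "dihedral_step n (i, e) (Gen_b, c) = (i, \<not> e)"

abbreviation dihedral_act :: "nat \<Rightarrow> int \<times> bool \<Rightarrow> dihedral_gen word \<Rightarrow> int \<times> bool" where
  "dihedral_act n \<equiv> foldl (dihedral_step n)"

definition dihedral_positions :: "nat \<Rightarrow> (int \<times> bool) set" where
  "dihedral_positions n = {0..<int n} \<times> UNIV"

lemma dihedral_step_in_positions:
  "n > 0 \<Longrightarrow> p \<in> dihedral_positions n \<Longrightarrow> dihedral_step n p l \<in> dihedral_positions n"
  by (cases "(n, p, l)" rule: dihedral_step.cases) (auto simp: dihedral_positions_def)

lemma dihedral_act_in_positions:
  "n > 0 \<Longrightarrow> p \<in> dihedral_positions n \<Longrightarrow> dihedral_act n p w \<in> dihedral_positions n"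
  by (induction w arbitrary: p) (auto simp: dihedral_step_in_positions)

lemma dihedral_act_power_a:
  assumes "(i, e) \<in> dihedral_positions n"
  shows "dihedral_act n (i, e) (replicate k (Gen_a, False)) =
    ((if e then i - int k else i + int k) mod int n, e)"
proof (induction k)
  case 0
  then show ?case using assms by (simp add: dihedral_positions_def)
next
  case (Suc k)
  have "replicate (Suc k) (Gen_a, False) = replicate k (Gen_a, False) @ [(Gen_a, False)]"
    by (simp add: replicate_append_same)
  then show ?case using Suc.IH by (simp add: mod_simps algebra_simps del: replicate_Suc)
qed

text \<open>
  The action is a concrete model of the presentation: the two sides of a relation move every
  position alike, and a cancelling pair of letters moves none. So words that act differently represent different elements.
\<close>

lemma dihedral_act_cong:
  assumes "word_eq (dihedral_relations n) u v" and n: "n > 0" and "p \<in> dihedral_positions n"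
  shows "dihedral_act n p u = dihedral_act n p v"
  using assms(1,3)
proof (induction arbitrary: p)
  case (word_eq_rel u v)
  obtain i e where p: "p = (i, e)" by fastforce
  have [simp]: "0 \<le> i" "i < int n" using word_eq_rel.prems by (auto simp: p dihedral_positions_def)
  \<comment> \<open>The power \<open>a ^ (n - 1)\<close> in the relation for \<open>ba\<close> moves like \<open>a\<inverse>\<close>, since \<open>n \<equiv> 0\<close> modulo \<open>n\<close>.\<close>
  have shift: "(i - (int n - 1)) mod int n = (i + 1) mod int n"
    "(i + (int n - 1)) mod int n = (i - 1) mod int n"
    by (simp_all add: mod_eq_dvd_iff)
  have "int (n - 1) = int n - 1" using n by simp
  then show ?case
    using word_eq_rel dihedral_act_power_a[of i e n]
    by (auto simp: dihedral_relations_def Let_def p shift)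
next
  case (word_eq_cancel x c)
  then show ?case
    by (cases x; cases p) (auto simp: dihedral_positions_def mod_simps)
next
  case (word_eq_append u u' v v')
  then show ?case using dihedral_act_in_positions[OF n] by simp
qed auto

text \<open>
  Any representative word may be applied to the origin \<open>(0, False)\<close>, the position of the neutral
  element; \<open>dihedral_coord_word_class\<close> below shows that the choice does not matter.
\<close>

definition dihedral_coord :: "nat \<Rightarrow> dihedral_gen word set \<Rightarrow> int \<times> bool" where
  "dihedral_coord n A = dihedral_act n (0, False) (SOME w. w \<in> A)"

lemma origin_in_positions: "n > 0 \<Longrightarrow> (0, False) \<in> dihedral_positions n"
  by (simp add: dihedral_positions_def)

lemma dihedral_coord_word_class:
  assumes "n > 0"
  shows "dihedral_coord n (word_class (dihedral_relations n) w) = dihedral_act n (0, False) w"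
proof -
  have "w \<in> word_class (dihedral_relations n) w" by (simp add: word_class_def word_eq_refl)
  then have "(SOME v. v \<in> word_class (dihedral_relations n) w) \<in> word_class (dihedral_relations n) w"
    by (rule someI)
  then show ?thesis
    using dihedral_act_cong[OF _ assms origin_in_positions[OF assms]]
    by (simp add: dihedral_coord_def word_class_def)
qed

definition dihedral_normal_form :: "nat \<Rightarrow> int \<times> bool \<Rightarrow> dihedral_gen word set" where
  "dihedral_normal_form n =
      (\<lambda>(i, e). dihedral_a n [^]\<^bsub>dihedral_group n\<^esub> i \<otimes>\<^bsub>dihedral_group n\<^esub>
     (if e then dihedral_b n else \<one>\<^bsub>dihedral_group n\<^esub>))"

interpretation dihedral: group "dihedral_group n" for n
  unfolding dihedral_group_def by (rule group_presented_group)

abbreviation dihedral_class ::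
  "nat \<Rightarrow> dihedral_gen word \<Rightarrow> dihedral_gen word set" where
  "dihedral_class n \<equiv> word_class (dihedral_relations n)"

lemma dihedral_carrier: "carrier (dihedral_group n) = range (dihedral_class n)"
  by (simp add: dihedral_group_def presented_group_def)

lemma dihedral_one: "\<one>\<^bsub>dihedral_group n\<^esub> = dihedral_class n []"
  by (simp add: dihedral_group_def presented_group_def)

lemma dihedral_mult:
  "dihedral_class n u \<otimes>\<^bsub>dihedral_group n\<^esub> dihedral_class n v =
    dihedral_class n (u @ v)"
  by (simp add: dihedral_group_def mult_word_class)

lemma dihedral_ab_closed [simp]:
  "dihedral_a n \<in> carrier (dihedral_group n)" "dihedral_b n \<in> carrier (dihedral_group n)"
  by (simp_all add: dihedral_a_def dihedral_b_def dihedral_carrier)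

lemma inv_letter: "inv\<^bsub>dihedral_group n\<^esub> (dihedral_class n [(x, c)]) =
    dihedral_class n [(x, \<not> c)]"
  by (rule dihedral.inv_equality)
    (use word_eq_cancel[of "dihedral_relations n" x "\<not> c"] in
      \<open>simp_all add: dihedral_mult dihedral_one word_class_eq_iff\<close>, simp_all add: dihedral_carrier)

lemma a_power: "dihedral_a n [^]\<^bsub>dihedral_group n\<^esub> (k :: nat) =
    dihedral_class n (replicate k (Gen_a, False))"
  by (induction k)
    (simp_all add: dihedral_one dihedral_a_def dihedral_mult replicate_append_same)

lemma a_power_n: "dihedral_a n [^]\<^bsub>dihedral_group n\<^esub> n =
    \<one>\<^bsub>dihedral_group n\<^esub>"
  unfolding a_power dihedral_one word_class_eq_iff
  by (rule word_eq_rel) (simp add: dihedral_relations_def Let_def)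

lemma b_square: "dihedral_b n \<otimes>\<^bsub>dihedral_group n\<^esub> dihedral_b n =
    \<one>\<^bsub>dihedral_group n\<^esub>"
  unfolding dihedral_b_def dihedral_mult dihedral_one word_class_eq_iff
  by (rule word_eq_rel) (simp add: dihedral_relations_def Let_def)

lemma inv_b: "inv\<^bsub>dihedral_group n\<^esub> dihedral_b n = dihedral_b n"
  by (rule dihedral.inv_equality) (simp_all add: b_square)

lemma inv_a:
  assumes n: "n > 0"
  shows "dihedral_a n [^]\<^bsub>dihedral_group n\<^esub> (n - 1) =
      inv\<^bsub>dihedral_group n\<^esub> dihedral_a n"
proof (rule dihedral.inv_equality[symmetric])
  show "dihedral_a n [^]\<^bsub>dihedral_group n\<^esub> (n - 1) \<otimes>\<^bsub>dihedral_group n\<^esub> dihedral_a n = \<one>\<^bsub>dihedral_group n\<^esub>"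
    using a_power_n n by (metis Suc_diff_1 dihedral.nat_pow_Suc)
qed simp_all

lemma b_a:
  assumes n: "n > 0"
  shows "dihedral_b n \<otimes>\<^bsub>dihedral_group n\<^esub> dihedral_a n =
      inv\<^bsub>dihedral_group n\<^esub> dihedral_a n \<otimes>\<^bsub>dihedral_group n\<^esub> dihedral_b n"
proof -
  have "dihedral_b n \<otimes>\<^bsub>dihedral_group n\<^esub> dihedral_a n =
      dihedral_a n [^]\<^bsub>dihedral_group n\<^esub> (n - 1) \<otimes>\<^bsub>dihedral_group n\<^esub> dihedral_b n"
    unfolding a_power unfolding dihedral_a_def dihedral_b_def dihedral_mult word_class_eq_iff
    by (rule word_eq_rel) (simp add: dihedral_relations_def Let_def)
  then show ?thesis unfolding inv_a[OF n] .
qed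

text \<open>
  The presentation says how \<open>b\<close> passes \<open>a\<close>; conjugating that relation by \<open>a\<close> says how it passes \<open>a\<inverse>\<close>.
\<close>

lemma b_inv_a:
  assumes n: "n > 0"
  shows "dihedral_b n \<otimes>\<^bsub>dihedral_group n\<^esub> inv\<^bsub>dihedral_group n\<^esub> dihedral_a n = dihedral_a n \<otimes>\<^bsub>dihedral_group n\<^esub> dihedral_b n"
proof -
  have "dihedral_a n \<otimes>\<^bsub>dihedral_group n\<^esub> dihedral_b n =
      (dihedral_a n \<otimes>\<^bsub>dihedral_group n\<^esub> (dihedral_b n \<otimes>\<^bsub>dihedral_group n\<^esub> dihedral_a n)) \<otimes>\<^bsub>dihedral_group n\<^esub> inv\<^bsub>dihedral_group n\<^esub> dihedral_a n"
    by (simp add: dihedral.m_assoc)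
  also have "\<dots> =
      (dihedral_a n \<otimes>\<^bsub>dihedral_group n\<^esub> inv\<^bsub>dihedral_group n\<^esub> dihedral_a n) \<otimes>\<^bsub>dihedral_group n\<^esub> dihedral_b n \<otimes>\<^bsub>dihedral_group n\<^esub> inv\<^bsub>dihedral_group n\<^esub> dihedral_a n"
    unfolding b_a[OF n] by (simp add: dihedral.m_assoc del: dihedral.r_inv dihedral.Units_r_inv)
  finally show ?thesis by simp
qed

lemma a_int_power_mod: "dihedral_a n [^]\<^bsub>dihedral_group n\<^esub> (i mod int n) =
    dihedral_a n [^]\<^bsub>dihedral_group n\<^esub> i"
proof -
  have "dihedral_a n [^]\<^bsub>dihedral_group n\<^esub> (int n * (i div int n) + i mod int n) =
      dihedral_a n [^]\<^bsub>dihedral_group n\<^esub> (i mod int n)"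
    by (subst dihedral.int_pow_mult, simp, subst dihedral.int_pow_pow[symmetric], simp)
      (simp add: int_pow_int a_power_n)
  then show ?thesis by simp
qed

text \<open>
  The step is what one gets by moving the letter past \<open>b\<^sup>e\<close> with \<open>b_a\<close> and \<open>b_inv_a\<close> and reducing the
  exponent of \<open>a\<close> modulo \<open>n\<close>.
\<close>

lemma normal_form_step:
  assumes n: "n > 0"
  shows "dihedral_normal_form n p \<otimes>\<^bsub>dihedral_group n\<^esub> dihedral_class n [l] =
      dihedral_normal_form n (dihedral_step n p l)"
proof -
  obtain i e x c where pl: "p = (i, e)" "l = (x, c)" by (metis surj_pair)
  have letters: "dihedral_class n [(Gen_a, False)] = dihedral_a n"
    "dihedral_class n [(Gen_a, True)] = inv\<^bsub>dihedral_group n\<^esub> dihedral_a n"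
    "dihedral_class n [(Gen_b, False)] = dihedral_b n"
    "dihedral_class n [(Gen_b, True)] = dihedral_b n"
    using inv_letter[of n Gen_a False] inv_letter[of n Gen_b False] inv_b
    by (simp_all add: dihedral_a_def dihedral_b_def)
  have succ: "dihedral_a n [^]\<^bsub>dihedral_group n\<^esub> (i + 1) =
      dihedral_a n [^]\<^bsub>dihedral_group n\<^esub> i \<otimes>\<^bsub>dihedral_group n\<^esub> dihedral_a n"
    by (simp add: dihedral.int_pow_mult dihedral.int_pow_1)
  have pred: "dihedral_a n [^]\<^bsub>dihedral_group n\<^esub> (i - 1) =
      dihedral_a n [^]\<^bsub>dihedral_group n\<^esub> i \<otimes>\<^bsub>dihedral_group n\<^esub> inv\<^bsub>dihedral_group n\<^esub> dihedral_a n"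
    by (simp add: dihedral.int_pow_diff dihedral.int_pow_1)
  show ?thesis
    by (cases x; cases e; cases c)
      (simp_all add: pl letters dihedral_normal_form_def a_int_power_mod succ pred dihedral.m_assoc
        b_a[OF n] b_inv_a[OF n] b_square)
qed

lemma normal_form_act:
  assumes n: "n > 0"
  shows "dihedral_normal_form n (dihedral_act n (0, False) w) = dihedral_class n w"
proof (induction w rule: rev_induct)
  case Nil
  then show ?case by (simp add: dihedral_normal_form_def dihedral_one dihedral_mult)
next
  case (snoc l w)
  then show ?case by (simp add: normal_form_step[OF n, symmetric] dihedral_mult)
qed

lemma coord_one:
  assumes n: "n > 0"
  shows "dihedral_coord n \<one>\<^bsub>dihedral_group n\<^esub> = (0, False)"
  by (simp add: dihedral_one dihedral_coord_word_class n)

lemma coord_step: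
  assumes n: "n > 0" and "A \<in> carrier (dihedral_group n)"
  shows "dihedral_coord n (A \<otimes>\<^bsub>dihedral_group n\<^esub> dihedral_class n [l]) =
      dihedral_step n (dihedral_coord n A) l"
  using assms by (auto simp: dihedral_carrier dihedral_mult dihedral_coord_word_class n)

text \<open>
  Injectivity holds because the normal form recovers an element from its coordinates, surjectivity
  because the word \<open>a\<^sup>i b\<^sup>e\<close> carries the origin to \<open>(i, e)\<close>.
\<close>

lemma bij_betw_coord:
  assumes n: "n > 0"
  shows "bij_betw (dihedral_coord n) (carrier (dihedral_group n)) (dihedral_positions n)"
proof (rule bij_betw_imageI)
  show "inj_on (dihedral_coord n) (carrier (dihedral_group n))"
    by (rule inj_on_inverseI[of _ "dihedral_normal_form n"])
      (auto simp: dihedral_carrier dihedral_coord_word_class n normal_form_act[OF n])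
  have "(i, e) \<in> dihedral_coord n ` carrier (dihedral_group n)" if "(i, e) \<in> dihedral_positions n" for i e
  proof -
    let ?w = "replicate (nat i) (Gen_a, False) @ (if e then [(Gen_b, False)] else [])"
    have "dihedral_coord n (dihedral_class n ?w) = (i, e)"
      using that dihedral_act_power_a[OF origin_in_positions[OF n], of "nat i"]
      by (simp add: dihedral_coord_word_class n dihedral_positions_def)
    then show ?thesis by (metis dihedral_carrier imageI rangeI)
  qed
  then show "dihedral_coord n ` carrier (dihedral_group n) = dihedral_positions n"
    using dihedral_act_in_positions[OF n origin_in_positions[OF n]]
    by (auto simp: dihedral_carrier dihedral_coord_word_class n)
qed

section \<open>Word length in the dihedral group\<close>

text \<open>
  The distance of \<open>(i, e)\<close> from the origin in the prism: the way around the \<open>n\<close>-cycle in the shorter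
  direction, and one more step to change the layer.
\<close>

fun position_length :: "nat \<Rightarrow> int \<times> bool \<Rightarrow> nat" where
  "position_length n (i, e) = min (nat i) (n - nat i) + (if e then 1 else 0)"

lemma position_length_step:
  assumes "p \<in> dihedral_positions n"
  shows "position_length n (dihedral_step n p l) \<le> Suc (position_length n p)"
proof -
  obtain i e x c where pl: "p = (i, e)" "l = (x, c)" by (metis surj_pair)
  have i: "0 \<le> i" "i < int n" using assms by (auto simp: pl dihedral_positions_def)
  have "(i + 1) mod int n = (if i + 1 = int n then 0 else i + 1)" using i by auto
  moreover have "(i - 1) mod int n = (if i = 0 then int n - 1 else i - 1)"
    using i by (auto simp: zmod_minus1)
  ultimately show ?thesis
    using i by (cases x) (auto simp: pl)
qed

text \<open>
  From the upper layer \<open>b\<close> descends; in the lower layer one goes back along the cycle if \<open>i\<close> is at most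
  half of \<open>n\<close>, and forward otherwise.
\<close>

lemma position_length_descent:
  assumes "p \<in> dihedral_positions n" and "p \<noteq> (0, False)"
  obtains x c where "position_length n p = Suc (position_length n (dihedral_step n p (x, c)))"
proof -
  obtain i e where p: "p = (i, e)" by (metis surj_pair)
  have i: "0 \<le> i" "i < int n" using assms by (auto simp: p dihedral_positions_def)
  show thesis
  proof (cases e)
    case True
    then show thesis using that[of Gen_b False] by (simp add: p)
  next
    case False
    then have pos: "i > 0" using assms(2) i by (simp add: p)
    show thesis
    proof (cases "2 * i \<le> int n")
      case True
      have "(i - 1) mod int n = i - 1" using i pos by simp
      then show thesis using that[of Gen_a True] False True pos i by (simp add: p)
    next
      case 2: False
      have "(i + 1) mod int n = (if i + 1 = int n then 0 else i + 1)" using i by auto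
      then show thesis using that[of Gen_a False] False 2 pos i by (simp add: p split: if_splits)
    qed
  qed
qed

text \<open>
  The distances in a cycle of length \<open>n + 2\<close> are \<open>0\<close> followed by those in a cycle of length \<open>n\<close>, all
  raised by one, together with one further \<open>1\<close>; this is an induction in steps of two.
\<close>

lemma sum_cycle_distance: "(\<Sum>i<n. min i (n - i)) = (n div 2) * (n - n div 2)" for n :: nat
proof (induction n rule: nat_induct2)
  case (step n)
  have "(\<Sum>i<n + 2. min i (n + 2 - i)) = (\<Sum>i<Suc n. min (Suc i) (n + 2 - Suc i))"
    using sum.lessThan_Suc_shift[of "\<lambda>i. min i (n + 2 - i)" "Suc n"] by simp
  also have "\<dots> = (\<Sum>i<Suc n. Suc (min i (n - i)))"
    by (intro sum.cong) auto
  also have "\<dots> = (\<Sum>i<n. min i (n - i)) + Suc n"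
    by (subst sum_Suc) simp
  also have "\<dots> = ((n + 2) div 2) * (n + 2 - (n + 2) div 2)"
  proof -
    define h k where "h = n div 2" and "k = n - h"
    have "n = h + k" "(n + 2) div 2 = Suc h" "n + 2 - Suc h = Suc k" by (auto simp: h_def k_def)
    then show ?thesis unfolding step.IH h_def[symmetric] k_def[symmetric] by simp
  qed
  finally show ?case .
qed simp_all

lemma sum_position_length:
  "(\<Sum>p\<in>dihedral_positions n. position_length n p) = 2 * (n div 2) * (n - n div 2) + n"
proof -
  have "(\<Sum>p\<in>dihedral_positions n. position_length n p) =
      (\<Sum>i\<in>{0..<int n}. \<Sum>e\<in>UNIV. position_length n (i, e))"
    unfolding dihedral_positions_def sum.cartesian_product by (intro sum.cong) auto
  also have "\<dots> = (\<Sum>i\<in>{0..<int n}. 2 * min (nat i) (n - nat i) + 1)"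
    by (simp add: UNIV_bool mult_2)
  also have "\<dots> = (\<Sum>i<n. 2 * min i (n - i) + 1)"
    by (rule sum.reindex_bij_witness[of _ int nat]) auto
  also have "\<dots> = 2 * (\<Sum>i<n. min i (n - i)) + n"
    by (simp only: sum.distrib sum_distrib_left) simp
  finally show ?thesis by (simp add: sum_cycle_distance)
qed

text \<open>
  With \<open>m = \<lfloor>n / 2\<rfloor>\<close> the two sides differ by \<open>(n - 2 m) - (n - 2 m)\<^sup>2\<close>, which vanishes because
  \<open>n - 2 m\<close> is \<open>0\<close> or \<open>1\<close>.
\<close>

lemma denominator_eq:
  "real (2 * (n div 2) * (n - n div 2) + n) =
    2 * real_of_int \<lfloor>real n / 2\<rfloor> * (real_of_int \<lfloor>real n / 2\<rfloor> + 1)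
      + real n ^ 2 - 2 * real n * real_of_int \<lfloor>real n / 2\<rfloor>"
proof -
  define m where "m = n div 2"
  have floor: "real_of_int \<lfloor>real n / 2\<rfloor> = real m"
    using floor_divide_of_nat_eq[of n 2, where 'a = real] by (simp add: m_def)
  have "n = 2 * m \<or> n = 2 * m + 1" by (auto simp: m_def)
  then show ?thesis
    unfolding floor m_def[symmetric] by (auto simp: algebra_simps power2_eq_square)
qed

section \<open>Curvature of the dihedral Cayley graph\<close>

theorem proposition3p1:
  fixes n :: nat
  assumes "n \<ge> 3"
  defines "G \<equiv> dihedral_group n"
    and "a \<equiv> dihedral_a n"
    and "b \<equiv> dihedral_b n"
  defines "S \<equiv> {a, inv\<^bsub>G\<^esub> a, b, inv\<^bsub>G\<^esub> b}"
  shows "\<forall>v \<in> pverts (cayley_graph G S).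
    steinerberger_curvature (cayley_graph G S) v =
      2 * real n /
        (2 * real_of_int \<lfloor>real n / 2\<rfloor> * (real_of_int \<lfloor>real n / 2\<rfloor> + 1)
          + real n ^ 2 - 2 * real n * real_of_int \<lfloor>real n / 2\<rfloor>)"
proof
  fix v assume v: "v \<in> pverts (cayley_graph G S)"
  have n: "n > 0" using assms(1) by simp
  interpret group G unfolding G_def dihedral_group_def by (rule group_presented_group)
  define len where "len A = position_length n (dihedral_coord n A)" for A
  let ?cls = "word_class (dihedral_relations n)"
  note bij = bij_betw_coord[OF n, folded G_def]
  have S: "S = range (\<lambda>l. ?cls [l])"
  proof -
    have "S = {?cls [(Gen_a, False)], ?cls [(Gen_a, True)], ?cls [(Gen_b, False)], ?cls [(Gen_b, True)]}"
      unfolding S_def a_def b_def G_def dihedral_a_def dihedral_b_def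
      by (simp add: inv_letter)
    moreover have letters: "UNIV = {(Gen_a, False), (Gen_a, True), (Gen_b, False), (Gen_b, True)}"
    proof -
      have "l \<in> {(Gen_a, False), (Gen_a, True), (Gen_b, False), (Gen_b, True)}" for l
        by (cases l; cases "fst l") auto
      then show ?thesis by blast
    qed
    ultimately show ?thesis unfolding letters by simp
  qed
  have S_carrier: "S \<subseteq> carrier G" by (auto simp: S G_def dihedral_carrier)
  have coord: "dihedral_coord n x \<in> dihedral_positions n" if "x \<in> carrier G" for x
    using bij that by (auto simp: bij_betw_def)
  have card: "card (carrier G) = 2 * n"
    using bij_betw_same_card[OF bij] by (simp add: dihedral_positions_def card_cartesian_product)
  have sum: "(\<Sum>x\<in>carrier G. len x) = 2 * (n div 2) * (n - n div 2) + n"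
    unfolding len_def sum_position_length[symmetric] by (rule sum.reindex_bij_betw[OF bij])
  have "steinerberger_curvature (cayley_graph G S) v =
      real (card (carrier G)) / real (\<Sum>x\<in>carrier G. len x)"
  proof (rule steinerberger_curvature_cayley_graph[OF is_group _ S_carrier _ _ _ _ v])
    show "finite (carrier G)" using card n card.infinite by fastforce
    show "len \<one>\<^bsub>G\<^esub> = 0" using n by (simp add: len_def G_def coord_one[OF n])
    show "len (x \<otimes>\<^bsub>G\<^esub> s) \<le> Suc (len x)" if "x \<in> carrier G" "s \<in> S" for x s
      using that position_length_step[OF coord[OF that(1)]]
      by (auto simp: S len_def G_def coord_step[OF n] simp del: position_length.simps)
    show "(\<Sum>x\<in>carrier G. len x) \<noteq> 0" using n by (simp add: sum)
  next
    fix y assume y: "y \<in> carrier G" "y \<noteq> \<one>\<^bsub>G\<^esub>"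
    then have "dihedral_coord n y \<noteq> (0, False)"
      using bij coord_one[OF n, folded G_def] by (metis bij_betw_def inj_on_eq_iff one_closed)
    then obtain x c where desc:
      "position_length n (dihedral_coord n y) =
        Suc (position_length n (dihedral_step n (dihedral_coord n y) (x, c)))"
      using position_length_descent[OF coord[OF y(1)]] by metis
    \<comment> \<open>Descending by a letter means arriving by the opposite letter.\<close>
    have s: "?cls [(x, c)] \<in> carrier G" "?cls [(x, \<not> c)] \<in> S" "?cls [(x, \<not> c)] \<in> carrier G"
      "inv\<^bsub>G\<^esub> (?cls [(x, c)]) = ?cls [(x, \<not> c)]"
      using S_carrier by (auto simp: S G_def inv_letter)
    have "y = (y \<otimes>\<^bsub>G\<^esub> ?cls [(x, c)]) \<otimes>\<^bsub>G\<^esub> ?cls [(x, \<not> c)]"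
      using y s(1) s(4)[symmetric] by (simp add: m_assoc)
    moreover have "len y = Suc (len (y \<otimes>\<^bsub>G\<^esub> ?cls [(x, c)]))"
      using desc y(1) by (simp add: len_def G_def coord_step[OF n])
    ultimately show "\<exists>x\<in>carrier G. \<exists>s\<in>S. y = x \<otimes>\<^bsub>G\<^esub> s \<and> len y = Suc (len x)"
      using s y(1) m_closed by blast
  qed
  then show "steinerberger_curvature (cayley_graph G S) v =
      2 * real n /
        (2 * real_of_int \<lfloor>real n / 2\<rfloor> * (real_of_int \<lfloor>real n / 2\<rfloor> + 1)
          + real n ^ 2 - 2 * real n * real_of_int \<lfloor>real n / 2\<rfloor>)"
    unfolding sum card denominator_eq by simp
qed

end
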